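(* There is an absolute constant $c>0$ such that for every finite set $A\subset\mathbb{R}$ with $|A|\geq 3$ and every transcendental $\alpha\in\mathbb{R}$, $$|A+\alpha.A| \geq c\,\frac{(\log|A|)^{4/3}}{(\log\log|A|)^{8/3}}\,|A|.$$
   Context: For $\alpha\in\mathbb{R}$ and $A\subset\mathbb{R}$, $\alpha.A:=\{\alpha a: a\in A\}$, and $A+B=\{a+b:a\in A,b\in B\}$. *)

theory Defs
  imports
    Complex_Main
    "HOL-Library.Set_Algebras"
    "HOL-Computational_Algebra.Polynomial"
begin

end

theory Submission
  imports
    Defs
    "HOL-Library.Function_Algebras"
    "HOL-Analysis.Harmonic_Numbers"
begin

text \<open>
  Suppose \<open>|A + \<alpha>.A| \<le> K |A|\<close>. Ruzsa's triangle inequality gives \<open>|A - A| \<le> K\<^sup>2 |A|\<close> and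
  \<open>|A \<plusminus> \<alpha>\<^sup>i.A| \<le> K\<^sup>i |A|\<close> for one choice of the sign. Expanding a dilate of \<open>A\<close> in a maximal
  \<open>\<int>[\<alpha>]\<close>-independent subset turns \<open>A\<close> into a set of finitely supported integer sequences on
  which \<open>\<alpha>\<close> acts as a shift. Compressing the coordinates from the highest to the lowest
  commutes with the shift and does not increase these sumsets, so it yields a down-set \<open>D\<close> of
  the same size satisfying the same bounds for \<open>D + D\<close> and \<open>D + \<alpha>\<^sup>i D\<close>.

  For a down-set, \<open>|D + D| \<ge> \<Sum>f\<in>D. 2 ^ |supp f|\<close>; hence half of \<open>D\<close> has supports of size at
  most \<open>s = O(log K)\<close>. For some \<open>i \<le> 2 s\<^sup>2\<close>, half of the pairs \<open>f, g\<close> of such elements have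
  \<open>supp f\<close> disjoint from the support of \<open>\<alpha>\<^sup>i g\<close>, and on those pairs \<open>f + \<alpha>\<^sup>i g\<close> is at most
  \<open>4\<^sup>s\<close>-to-one. So \<open>|D|\<^sup>2 = O(4\<^sup>s K\<^sup>i |D|)\<close>, that is \<open>log |A| = O(log\<^sup>3 K)\<close>, which is stronger
  than the claim.
\<close>

section \<open>Ruzsa's triangle inequality\<close>

text \<open>Fix one representation \<open>w = x + z\<close> for every \<open>w\<close> in
  \<open>X + Z\<close> and send \<open>(w, y)\<close> to \<open>(x - y, y + z)\<close>. The two
  entries add up to \<open>w\<close>, which determines \<open>x\<close> and \<open>z\<close> and
  then \<open>y\<close>, so the map is injective.\<close>

lemma ruzsa_triangle:
  fixes X Y Z :: "'a::ab_group_add set"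
  assumes "finite X" "finite Y" "finite Z"
  shows "card (X + Z) * card Y \<le> card (X + uminus ` Y) * card (Y + Z)"
proof -
  define P where "P w = (SOME p. fst p \<in> X \<and> snd p \<in> Z \<and> w = fst p + snd p)" for w
  have P: "fst (P w) \<in> X" "snd (P w) \<in> Z" "fst (P w) + snd (P w) = w" if "w \<in> X + Z" for w
  proof -
    have "\<exists>p. fst p \<in> X \<and> snd p \<in> Z \<and> w = fst p + snd p"
      using that by (force simp: set_plus_def)
    from someI_ex[OF this] show "fst (P w) \<in> X" "snd (P w) \<in> Z" "fst (P w) + snd (P w) = w"
      by (auto simp: P_def)
  qed
  define h where "h = (\<lambda>(w, y). (fst (P w) + - y, y + snd (P w)))"
  have inj: "inj_on h ((X + Z) \<times> Y)"
  proof (rule inj_onI, clarify)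
    fix w y w' y'
    assume a: "w \<in> X + Z" "w' \<in> X + Z" and h: "h (w, y) = h (w', y')"
    have e: "fst (P w) - y = fst (P w') - y'" "y + snd (P w) = y' + snd (P w')"
      using h by (simp_all add: h_def)
    have "w = (fst (P w) - y) + (y + snd (P w))" using P(3)[OF a(1)] by simp
    also have "\<dots> = (fst (P w') - y') + (y' + snd (P w'))" unfolding e ..
    also have "\<dots> = w'" using P(3)[OF a(2)] by simp
    finally have "w = w'" .
    with e(2) show "w = w' \<and> y = y'" by simp
  qed
  have "h ` ((X + Z) \<times> Y) \<subseteq> (X + uminus ` Y) \<times> (Y + Z)"
    using P(1,2)
    by (auto simp: h_def diff_conv_add_uminus simp del: add_uminus_conv_diff intro!: set_plus_intro)
  from card_inj_on_le[OF inj this] show ?thesis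
    using assms by (simp add: card_cartesian_product finite_set_plus)
qed

section \<open>Compressions\<close>

text \<open>The value \<open>g i\<close> is irrelevant: \<open>g\<close> only names a line in
  direction \<open>i\<close>.\<close>

definition fibre :: "nat \<Rightarrow> (nat \<Rightarrow> int) set \<Rightarrow> (nat \<Rightarrow> int) \<Rightarrow> int set" where
  "fibre i F g = {t. g(i := t) \<in> F}"

text \<open>On each line in direction \<open>i\<close>, the points of a finite \<open>F\<close> are
  pushed onto an initial segment of the nonnegative integers.\<close>

definition compress :: "nat \<Rightarrow> (nat \<Rightarrow> int) set \<Rightarrow> (nat \<Rightarrow> int) set" where
  "compress i F = {g. 0 \<le> g i \<and> g i < int (card (fibre i F g))}"

text \<open>
  Compressing the highest coordinate first is what makes the operation commute with shifts:
  the compressions beyond the support, and those of the zeros created by the shift, do nothing.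
\<close>
fun compress_upto :: "nat \<Rightarrow> (nat \<Rightarrow> int) set \<Rightarrow> (nat \<Rightarrow> int) set" where
  "compress_upto 0 F = F"
| "compress_upto (Suc n) F = compress_upto n (compress n F)"

definition shift :: "nat \<Rightarrow> (nat \<Rightarrow> int) \<Rightarrow> (nat \<Rightarrow> int)" where
  "shift m f = (\<lambda>k. if k < m then 0 else f (k - m))"

text \<open>One sign per coordinate rather than a global sign, because compressing coordinate
  \<open>i\<close> erases only the sign at \<open>i\<close>.\<close>

definition flip :: "(nat \<Rightarrow> int) \<Rightarrow> (nat \<Rightarrow> int) \<Rightarrow> (nat \<Rightarrow> int)" where
  "flip s f = (\<lambda>k. s k * f k)"

definition below :: "nat \<Rightarrow> (nat \<Rightarrow> int) set" where
  "below N = {f. \<forall>k\<ge>N. f k = 0}"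

text \<open>Being a down-set is split into single directions, since each compression secures one
  direction at a time.\<close>

definition down_at :: "nat \<Rightarrow> (nat \<Rightarrow> int) set \<Rightarrow> bool" where
  "down_at j F \<longleftrightarrow> (\<forall>f\<in>F. 0 \<le> f j \<and> (\<forall>t. 0 \<le> t \<and> t \<le> f j \<longrightarrow> f(j := t) \<in> F))"

definition supp :: "(nat \<Rightarrow> int) \<Rightarrow> nat set" where
  "supp f = {k. f k \<noteq> 0}"

section \<open>Fibres and the size of a compression\<close>

lemma fibre_upd [simp]: "fibre i F (g(i := t)) = fibre i F g"
  by (simp add: fibre_def)

lemma finite_fibre: "finite F \<Longrightarrow> finite (fibre i F g)"
proof -
  assume "finite F"
  moreover have "fibre i F g \<subseteq> (\<lambda>f. f i) ` F"
  proof
    fix t assume "t \<in> fibre i F g"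
    then have "g(i := t) \<in> F" by (simp add: fibre_def)
    then show "t \<in> (\<lambda>f. f i) ` F" by (rule rev_image_eqI) simp
  qed
  ultimately show ?thesis by (meson finite_imageI finite_subset)
qed

lemma fibre_nonempty_if_compress: "g \<in> compress i F \<Longrightarrow> \<exists>t. g(i := t) \<in> F"
proof -
  assume "g \<in> compress i F"
  then have "fibre i F g \<noteq> {}" by (auto simp: compress_def)
  then show ?thesis by (auto simp: fibre_def)
qed

text \<open>The set \<open>G\<close> is the disjoint union of its lines in direction
  \<open>i\<close>, indexed by their points with \<open>i\<close>-th coordinate 0. The base
  \<open>H\<close> may be larger than the projection of \<open>G\<close>, the extra fibres being
  empty; this allows the same base for a set and its compression.\<close>

lemma slices:
  assumes "\<And>g. g \<in> G \<Longrightarrow> g(i := 0) \<in> H" "\<And>h. h \<in> H \<Longrightarrow> h i = 0"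
  shows "bij_betw (\<lambda>(h, t). h(i := t)) (Sigma H (fibre i G)) G"
  unfolding bij_betw_def
proof
  show "inj_on (\<lambda>(h, t). h(i := t)) (Sigma H (fibre i G))"
  proof (rule inj_onI, clarify)
    fix h t h' t' assume a: "h \<in> H" "h' \<in> H" and e: "h(i := t) = h'(i := t')"
    have "(h(i := t)) k = (h'(i := t')) k" for k using e by simp
    then have "h k = h' k" if "k \<noteq> i" for k using that by (metis fun_upd_other)
    with assms(2) a have "h = h'" by (metis ext)
    moreover from e have "t = t'" by (metis fun_upd_same)
    ultimately show "h = h' \<and> t = t'" by simp
  qed
  show "(\<lambda>(h, t). h(i := t)) ` Sigma H (fibre i G) = G"
  proof safe
    fix g assume "g \<in> G"
    then show "g \<in> (\<lambda>(h, t). h(i := t)) ` Sigma H (fibre i G)"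
      using assms(1)[of g] by (intro image_eqI[of _ _ "(g(i := 0), g i)"]) (auto simp: fibre_def)
  qed (auto simp: fibre_def)
qed

lemma fibre_compress: "fibre i (compress i F) g = {0..<int (card (fibre i F g))}"
proof -
  have "t \<in> fibre i (compress i F) g \<longleftrightarrow> g(i := t) \<in> compress i F" for t
    by (simp add: fibre_def)
  also have "\<dots> t \<longleftrightarrow> t \<in> {0..<int (card (fibre i F g))}" for t
    by (simp add: compress_def)
  finally show ?thesis by blast
qed

text \<open>Both sets are sliced over the projection \<open>H\<close> of \<open>F\<close>, and
  corresponding fibres have equal size.\<close>

lemma
  assumes "finite F"
  shows finite_compress: "finite (compress i F)" and card_compress: "card (compress i F) = card F"
proof -
  define H where "H = (\<lambda>f. f(i := 0)) ` F"
  have H: "finite H" "\<And>h. h \<in> H \<Longrightarrow> h i = 0" using assms by (auto simp: H_def)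
  have 1: "bij_betw (\<lambda>(h, t). h(i := t)) (Sigma H (fibre i F)) F"
    by (rule slices) (auto simp: H_def)
  have 2: "bij_betw (\<lambda>(h, t). h(i := t)) (Sigma H (fibre i (compress i F))) (compress i F)"
  proof (rule slices)
    fix g assume "g \<in> compress i F"
    then obtain t where "g(i := t) \<in> F" using fibre_nonempty_if_compress by blast
    then show "g(i := 0) \<in> H" unfolding H_def by (metis fun_upd_upd image_eqI)
  qed (use H in auto)
  have "finite (Sigma H (fibre i (compress i F)))" using H by (auto simp: fibre_compress)
  with 2 show "finite (compress i F)" using bij_betw_finite by blast
  show "card (compress i F) = card F"
    using bij_betw_same_card[OF 1] bij_betw_same_card[OF 2] H(1) assms
    by (simp add: card_SigmaI finite_fibre fibre_compress)
qed

section \<open>Compressions and sumsets\<close>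

text \<open>The translates \<open>S + Min T\<close> and \<open>Max S + T\<close> both lie in
  \<open>S + T\<close> and share only the point \<open>Max S + Min T\<close>.\<close>

lemma card_int_sumset_ge:
  fixes S T :: "int set"
  assumes "finite S" "finite T" "S \<noteq> {}" "T \<noteq> {}"
  shows "card S + card T \<le> card (S + T) + 1"
proof -
  let ?X = "(\<lambda>s. s + Min T) ` S" and ?Y = "(\<lambda>t. Max S + t) ` T"
  have fin: "finite (S + T)" using assms by (simp add: finite_set_plus)
  have "?X \<inter> ?Y \<subseteq> {Max S + Min T}"
  proof
    fix z assume "z \<in> ?X \<inter> ?Y"
    then obtain s t where "s \<in> S" "t \<in> T" "z = s + Min T" "z = Max S + t" by blast
    moreover have "s \<le> Max S" "Min T \<le> t" using calculation assms by auto
    ultimately show "z \<in> {Max S + Min T}" by auto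
  qed
  then have "card (?X \<inter> ?Y) \<le> 1" by (metis card_mono card.empty finite.emptyI finite_insert card_insert_disjoint empty_iff One_nat_def)
  moreover have "card ?X = card S" "card ?Y = card T" by (auto intro!: card_image inj_onI)
  moreover have "card ?X + card ?Y = card (?X \<union> ?Y) + card (?X \<inter> ?Y)"
    using assms by (intro card_Un_Int) auto
  moreover have "?X \<union> ?Y \<subseteq> S + T" using assms by (auto intro!: set_plus_intro Min_in Max_in)
  then have "card (?X \<union> ?Y) \<le> card (S + T)" using fin card_mono by blast
  ultimately show ?thesis by linarith
qed

text \<open>The sumset of two fibres lies in a fibre of \<open>F + G\<close>. If the two fibres have
  \<open>a\<close> and \<open>b\<close> points, that fibre has at least \<open>a + b - 1\<close>,
  while the coordinates being added are at most \<open>a - 1\<close> and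
  \<open>b - 1\<close>.\<close>

lemma compress_plus_subset:
  assumes "finite F" "finite G"
  shows "compress i F + compress i G \<subseteq> compress i (F + G)"
proof
  fix h assume "h \<in> compress i F + compress i G"
  then obtain f g where f: "f \<in> compress i F" and g: "g \<in> compress i G" and h: "h = f + g"
    by (auto simp: set_plus_def)
  have "fibre i F f + fibre i G g \<subseteq> fibre i (F + G) (f + g)"
  proof
    fix z assume "z \<in> fibre i F f + fibre i G g"
    then obtain s t where st: "f(i := s) \<in> F" "g(i := t) \<in> G" "z = s + t"
      by (auto simp: set_plus_def fibre_def)
    have "(f + g)(i := z) = f(i := s) + g(i := t)" using st(3) by auto
    then show "z \<in> fibre i (F + G) (f + g)" using st by (auto simp: fibre_def)
  qed
  then have "card (fibre i F f + fibre i G g) \<le> card (fibre i (F + G) (f + g))"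
    using assms by (intro card_mono finite_fibre finite_set_plus)
  moreover have "fibre i F f \<noteq> {}" "fibre i G g \<noteq> {}"
    using f g by (auto simp: compress_def)
  then have "card (fibre i F f) + card (fibre i G g) \<le> card (fibre i F f + fibre i G g) + 1"
    using assms by (intro card_int_sumset_ge finite_fibre)
  ultimately show "h \<in> compress i (F + G)" using f g h by (auto simp: compress_def)
qed

lemma compress_mono: "finite G \<Longrightarrow> F \<subseteq> G \<Longrightarrow> compress i F \<subseteq> compress i G"
proof
  fix g assume a: "finite G" "F \<subseteq> G" "g \<in> compress i F"
  then have "card (fibre i F g) \<le> card (fibre i G g)"
    by (intro card_mono finite_fibre) (auto simp: fibre_def)
  with a(3) show "g \<in> compress i G" by (auto simp: compress_def)
qed

lemma
  assumes "finite F"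
  shows finite_compress_upto: "finite (compress_upto n F)"
    and card_compress_upto: "card (compress_upto n F) = card F"
  using assms by (induction n arbitrary: F) (auto simp: finite_compress card_compress)

lemma compress_upto_mono: "finite G \<Longrightarrow> F \<subseteq> G \<Longrightarrow> compress_upto n F \<subseteq> compress_upto n G"
proof (induction n arbitrary: F G)
  case (Suc n)
  then show ?case by (simp add: Suc.IH compress_mono finite_compress)
qed simp

lemma compress_upto_plus_subset:
  assumes "finite F" "finite G"
  shows "compress_upto n F + compress_upto n G \<subseteq> compress_upto n (F + G)"
  using assms
proof (induction n arbitrary: F G)
  case (Suc n)
  have "compress_upto n (compress n F) + compress_upto n (compress n G)
      \<subseteq> compress_upto n (compress n F + compress n G)"
    using Suc by (simp add: finite_compress)
  also have "\<dots> \<subseteq> compress_upto n (compress n (F + G))"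
    using Suc.prems
    by (intro compress_upto_mono compress_plus_subset) (auto simp: finite_compress finite_set_plus)
  finally show ?case by simp
qed simp

lemma card_compress_upto_plus_le:
  assumes "finite F" "finite G"
  shows "card (compress_upto n F + compress_upto n G) \<le> card (F + G)"
proof -
  have "card (compress_upto n F + compress_upto n G) \<le> card (compress_upto n (F + G))"
    using assms by (intro card_mono finite_compress_upto finite_set_plus compress_upto_plus_subset)
  then show ?thesis using assms by (simp add: card_compress_upto finite_set_plus)
qed

section \<open>Compressions, supports and shifts\<close>

lemma compress_below: "F \<subseteq> below N \<Longrightarrow> i < N \<Longrightarrow> compress i F \<subseteq> below N"
proof
  fix g assume a: "F \<subseteq> below N" "i < N" "g \<in> compress i F"
  then obtain t where "g(i := t) \<in> below N" using fibre_nonempty_if_compress by blast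
  then show "g \<in> below N" using a(2) by (auto simp: below_def)
qed

lemma compress_upto_below: "F \<subseteq> below N \<Longrightarrow> n \<le> N \<Longrightarrow> compress_upto n F \<subseteq> below N"
  by (induction n arbitrary: F) (simp_all add: compress_below)

lemma compress_trivial:
  assumes "\<And>f. f \<in> F \<Longrightarrow> f i = 0"
  shows "compress i F = F"
proof -
  have "fibre i F g = (if g(i := 0) \<in> F then {0} else {})" for g
  proof -
    have "t = 0" if "g(i := t) \<in> F" for t using assms[OF that] by simp
    then show ?thesis by (auto simp: fibre_def)
  qed
  then have "g \<in> compress i F \<longleftrightarrow> g i = 0 \<and> g(i := 0) \<in> F" for g
    by (auto simp: compress_def)
  moreover have "g i = 0 \<and> g(i := 0) \<in> F \<longleftrightarrow> g \<in> F" for g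
    using assms by (metis fun_upd_triv)
  ultimately show ?thesis by auto
qed

lemma compress_upto_beyond: "F \<subseteq> below n \<Longrightarrow> compress_upto (n + m) F = compress_upto n F"
proof (induction m)
  case (Suc m)
  have "compress (n + m) F = F"
    using Suc.prems by (intro compress_trivial) (auto simp: below_def)
  with Suc show ?case by simp
qed simp

lemma inj_shift: "inj (shift m)"
proof (rule injI)
  fix f g assume "shift m f = shift m g"
  then have "shift m f (k + m) = shift m g (k + m)" for k by simp
  then show "f = g" by (auto simp: shift_def)
qed

lemma fibre_shift: "fibre (i + m) (shift m ` F) (shift m g) = fibre i F g"
proof -
  have "(shift m g)(i + m := t) = shift m (g(i := t))" for t
    by (auto simp: shift_def fun_eq_iff)
  then show ?thesis by (auto simp: fibre_def inj_image_mem_iff[OF inj_shift])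
qed

lemma compress_shift: "compress (i + m) (shift m ` F) = shift m ` compress i F"
proof -
  have *: "shift m g \<in> compress (i + m) (shift m ` F) \<longleftrightarrow> g \<in> compress i F" for g
    by (simp add: compress_def fibre_shift) (simp add: shift_def)
  \<comment> \<open>A point of the compression differs from some shifted sequence only at
    \<open>i + m\<close>, so it vanishes below \<open>m\<close> and is itself a shift.\<close>
  have "\<exists>g. h = shift m g" if h: "h \<in> compress (i + m) (shift m ` F)" for h
  proof -
    obtain t f where "h(i + m := t) = shift m f"
      using fibre_nonempty_if_compress[OF h] by blast
    then have "(h(i + m := t)) k = 0" if "k < m" for k using that by (simp add: shift_def)
    then have "h k = 0" if "k < m" for k using that by fastforce
    then have "h = shift m (\<lambda>k. h (k + m))" by (auto simp: shift_def fun_eq_iff)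
    then show ?thesis by blast
  qed
  with * show ?thesis by blast
qed

lemma compress_upto_shift_low: "n \<le> m \<Longrightarrow> compress_upto n (shift m ` F) = shift m ` F"
proof (induction n)
  case (Suc n)
  have "compress n (shift m ` F) = shift m ` F"
    using Suc.prems by (intro compress_trivial) (auto simp: shift_def)
  with Suc show ?case by simp
qed simp

lemma compress_upto_shift: "compress_upto (n + m) (shift m ` F) = shift m ` compress_upto n F"
proof (induction n arbitrary: F)
  case 0
  show ?case using compress_upto_shift_low[of m m] by simp
qed (simp add: compress_shift)

section \<open>Compressions and signs\<close>

text \<open>Negating a fibre does not change its size, so the sign at \<open>i\<close> is forgotten;
  the signs at the other coordinates only permute the lines.\<close>

lemma compress_flip:
  assumes "\<And>k. s k = 1 \<or> s k = -1"
  shows "compress i (flip s ` F) = flip (s(i := 1)) ` compress i F"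
proof -
  let ?s = "s(i := 1)"
  have s2: "s k * s k = 1" for k using assms[of k] by auto
  have ff: "flip s (flip s f) = f" for f
    by (simp add: flip_def fun_eq_iff s2 flip: mult.assoc)
  have ff': "flip ?s (flip ?s f) = f" for f
    using s2 by (auto simp: flip_def fun_eq_iff simp flip: mult.assoc)
  have mem: "g \<in> flip s ` F \<longleftrightarrow> flip s g \<in> F" for g
    using ff by (metis image_iff)
  have "fibre i (flip s ` F) g = (*) (s i) ` fibre i F (flip ?s g)" for g
  proof -
    have eq: "flip s (g(i := t)) = (flip ?s g)(i := s i * t)" for t
      by (simp add: flip_def fun_eq_iff)
    have "t \<in> fibre i (flip s ` F) g \<longleftrightarrow> s i * t \<in> fibre i F (flip ?s g)" for t
      by (simp add: fibre_def mem eq del: fun_upd_apply)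
    moreover have "s i * t \<in> B \<longleftrightarrow> t \<in> (*) (s i) ` B" for t B
      using s2[of i] by (metis (no_types, lifting) image_iff mult.assoc mult_1)
    ultimately show ?thesis by blast
  qed
  moreover have "card ((*) (s i) ` B) = card B" for B
    using assms[of i] by (intro card_image inj_onI) auto
  ultimately have "g \<in> compress i (flip s ` F) \<longleftrightarrow> flip ?s g \<in> compress i F" for g
    by (simp add: compress_def flip_def)
  then have "g \<in> compress i (flip s ` F) \<longleftrightarrow> g \<in> flip ?s ` compress i F" for g
    using ff' by (metis (no_types, lifting) image_iff)
  then show ?thesis by blast
qed

section \<open>Compressed sets are down-sets\<close>

lemma down_at_compress_same: "down_at i (compress i F)"
  by (auto simp: down_at_def compress_def)

text \<open>If \<open>F\<close> is down-closed in direction \<open>j\<close>, lowering the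
  \<open>j\<close>-th coordinate of a line in another direction \<open>i\<close> can only enlarge
  its fibre.\<close>

lemma down_at_compress:
  assumes "finite F" "down_at j F"
  shows "down_at j (compress i F)"
proof (cases "i = j")
  case False
  show ?thesis unfolding down_at_def
  proof (intro ballI conjI allI impI)
    fix g assume g: "g \<in> compress i F"
    then obtain u where "g(i := u) \<in> F" using fibre_nonempty_if_compress by blast
    with assms(2) False show "0 \<le> g j" by (auto simp: down_at_def dest!: bspec)
    fix t assume t: "0 \<le> t \<and> t \<le> g j"
    have "fibre i F g \<subseteq> fibre i F (g(j := t))"
    proof
      fix u assume "u \<in> fibre i F g"
      then have "g(i := u) \<in> F" by (simp add: fibre_def)
      with assms(2) t False have "(g(i := u))(j := t) \<in> F" by (auto simp: down_at_def dest!: bspec)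
      then show "u \<in> fibre i F (g(j := t))" using False by (simp add: fibre_def fun_upd_twist)
    qed
    then have "card (fibre i F g) \<le> card (fibre i F (g(j := t)))"
      using assms by (intro card_mono finite_fibre)
    with g False show "g(j := t) \<in> compress i F" by (auto simp: compress_def)
  qed
qed (simp add: down_at_compress_same)

text \<open>The hypothesis on \<open>j\<close> is the induction invariant: compressions run through
  \<open>n - 1\<close> down to \<open>0\<close>, each gaining its own direction and keeping those
  already gained.\<close>

lemma down_at_compress_upto:
  assumes "finite F" "\<And>j. n \<le> j \<Longrightarrow> down_at j F"
  shows "down_at j (compress_upto n F)"
  using assms
proof (induction n arbitrary: F)
  case (Suc n)
  have "down_at j (compress n F)" if "n \<le> j" for j
  proof (cases "j = n")
    case False
    with that Suc.prems show ?thesis by (intro down_at_compress) auto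
  qed (simp add: down_at_compress_same)
  with Suc show ?case by (simp add: finite_compress)
qed simp

text \<open>Coordinates are lowered one at a time; only those below \<open>N\<close> can
  differ.\<close>

lemma down_closed:
  assumes "\<And>j. down_at j D" "D \<subseteq> below N" "f \<in> D" "\<And>k. 0 \<le> g k" "\<And>k. g k \<le> f k"
  shows "g \<in> D"
proof -
  have "(\<lambda>k. if k < n then g k else f k) \<in> D" for n
  proof (induction n)
    case (Suc n)
    have "(\<lambda>k. if k < Suc n then g k else f k) = (\<lambda>k. if k < n then g k else f k)(n := g n)"
      by (auto simp: less_Suc_eq)
    also have "\<dots> \<in> D" using Suc assms(1)[of n] assms(4,5)[of n] by (auto simp: down_at_def dest!: bspec)
    finally show ?case .
  qed (use assms in simp)
  from this[of N] have "(\<lambda>k. if k < N then g k else f k) \<in> D" .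
  moreover have "f k = 0" "g k = 0" if "k \<ge> N" for k
    using that assms(2,3) assms(4,5)[of k] by (auto simp: below_def)
  then have "(\<lambda>k. if k < N then g k else f k) = g" by (auto simp: fun_eq_iff)
  ultimately show ?thesis by simp
qed

lemma compress_upto_flip:
  assumes "\<And>k. s k = 1 \<or> s k = -1"
  shows "compress_upto n (flip s ` F) = flip (\<lambda>k. if k < n then 1 else s k) ` compress_upto n F"
  using assms
proof (induction n arbitrary: s F)
  case 0
  show ?case by simp
next
  case (Suc n)
  have "compress_upto (Suc n) (flip s ` F) = compress_upto n (flip (s(n := 1)) ` compress n F)"
    using Suc.prems by (simp add: compress_flip)
  also have "\<dots> = flip (\<lambda>k. if k < n then 1 else (s(n := 1)) k) ` compress_upto n (compress n F)"
    using Suc.prems by (intro Suc.IH) auto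
  also have "(\<lambda>k. if k < n then 1 else (s(n := 1)) k) = (\<lambda>k. if k < Suc n then 1 else s k)"
    by (auto simp: fun_eq_iff)
  finally show ?case by simp
qed

text \<open>Since compression does not see signs, bounds on differences and on sums with either sign
  all become bounds on plain sums of the compressed set.\<close>

lemma compress_upto_flip_below:
  assumes "\<And>k. s k = 1 \<or> s k = -1" "F \<subseteq> below n"
  shows "compress_upto n (flip s ` F) = compress_upto n F"
proof -
  have "flip (\<lambda>k. if k < n then 1 else s k) f = f" if "f \<in> compress_upto n F" for f
    using compress_upto_below[OF assms(2) order.refl] that
    by (force simp: flip_def below_def fun_eq_iff)
  then show ?thesis using assms(1) by (simp add: compress_upto_flip)
qed

section \<open>Sums of down-sets\<close>

lemma finite_supp: "f \<in> below N \<Longrightarrow> finite (supp f)"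
proof -
  assume "f \<in> below N"
  then have "supp f \<subseteq> {..<N}" by (auto simp: supp_def below_def not_le[symmetric])
  then show ?thesis using finite_subset by blast
qed

text \<open>
  The pair of \<open>f\<close> and \<open>S \<subseteq> supp f\<close> is sent to \<open>f + (f - 1\<^sub>S)\<close>, from which \<open>S\<close> is recovered
  as the set of odd coordinates.
\<close>
lemma card_downset_double_ge:
  assumes "finite D" "\<And>j. down_at j D" "D \<subseteq> below N"
  shows "(\<Sum>f\<in>D. 2 ^ card (supp f)) \<le> card (D + D)"
proof -
  define h where "h = (\<lambda>(f, S). \<lambda>k::nat. 2 * f k - (if k \<in> S then 1 else 0 :: int))"
  have fin: "finite (supp f)" if "f \<in> D" for f using that assms(3) finite_supp by blast
  have "inj_on h (Sigma D (\<lambda>f. Pow (supp f)))"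
  proof (rule inj_onI, clarify)
    fix f S f' S' assume "h (f, S) = h (f', S')"
    then have e: "2 * f k - (if k \<in> S then 1 else 0) = 2 * f' k - (if k \<in> S' then 1 else 0)" for k
      by (auto simp: h_def fun_eq_iff)
    have S: "k \<in> S \<longleftrightarrow> k \<in> S'" for k
      using e[of k] by (cases "k \<in> S"; cases "k \<in> S'"; simp; presburger)
    then have "f k = f' k" for k using e[of k] by auto
    with S show "f = f' \<and> S = S'" by auto
  qed
  moreover have "h ` Sigma D (\<lambda>f. Pow (supp f)) \<subseteq> D + D"
  proof clarify
    fix f S assume f: "f \<in> D" and S: "S \<subseteq> supp f"
    define g where "g = (\<lambda>k. f k - (if k \<in> S then 1 else 0))"
    have pos: "0 \<le> f k" for k using assms(2)[of k] f by (auto simp: down_at_def)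
    have "1 \<le> f k" if "k \<in> S" for k
      using pos[of k] S that by (force simp: supp_def)
    then have "g \<in> D" using pos f by (intro down_closed[OF assms(2,3) f]) (auto simp: g_def)
    moreover have "h (f, S) = f + g" by (auto simp: h_def g_def fun_eq_iff)
    ultimately show "h (f, S) \<in> D + D" using f by (auto intro: set_plus_intro)
  qed
  ultimately have "card (Sigma D (\<lambda>f. Pow (supp f))) \<le> card (D + D)"
    using assms(1) by (intro card_inj_on_le finite_set_plus)
  then show ?thesis using assms(1) fin by (simp add: card_SigmaI card_Pow)
qed

text \<open>
  A sum of two disjointly supported functions determines both of them up to the choice of the
  support of the first, a subset of a set of size at most \<open>2 * s\<close>.
\<close>
lemma card_disjoint_pairs_le:
  assumes "finite E" "\<And>f. f \<in> E \<Longrightarrow> finite (supp f) \<and> card (supp f) \<le> s"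
  shows "card {(f, g) \<in> E \<times> E. supp f \<inter> supp (shift m g) = {}} \<le> 4 ^ s * card (E + shift m ` E)"
    (is "card ?P \<le> _")
proof -
  define C where "C = (\<lambda>(f, g). f + shift m g) ` ?P"
  define h where "h = (\<lambda>(f, g). (f + shift m g, supp f))"
  have finP: "finite ?P" using assms(1) by (auto intro: finite_subset[of _ "E \<times> E"])
  have supp_shift: "supp (shift m g) = (\<lambda>k. k + m) ` supp g" for g
  proof -
    have "k \<in> (\<lambda>k. k + m) ` supp g" if "k \<in> supp (shift m g)" for k
      using that by (intro image_eqI[of _ _ "k - m"]) (auto simp: supp_def shift_def split: if_splits)
    then show ?thesis by (auto simp: supp_def shift_def)
  qed
  have sub: "supp (f + shift m g) \<subseteq> supp f \<union> supp (shift m g)" for f g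
    by (auto simp: supp_def)
  have c: "finite (supp c) \<and> card (supp c) \<le> 2 * s" if cC: "c \<in> C" for c
  proof -
    obtain f g where fg: "f \<in> E" "g \<in> E" "c = f + shift m g" using cC by (auto simp: C_def)
    have "finite (supp (shift m g))" "card (supp (shift m g)) \<le> s"
      using assms(2)[OF fg(2)] by (auto simp: supp_shift card_image)
    moreover have "card (supp c) \<le> card (supp f \<union> supp (shift m g))"
      using sub[of f g] fg(3) assms(2)[OF fg(1)] calculation by (auto intro: card_mono)
    ultimately show ?thesis
      using sub[of f g] fg(3) assms(2)[OF fg(1)] card_Un_le[of "supp f" "supp (shift m g)"]
      by (auto intro: finite_subset)
  qed
  have "inj_on h ?P"
  proof (rule inj_onI, clarify)
    fix f g f' g'
    assume d: "supp f \<inter> supp (shift m g) = {}" "supp f' \<inter> supp (shift m g') = {}"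
      and e: "h (f, g) = h (f', g')"
    have r: "f = (\<lambda>k. if k \<in> supp f then (f + shift m g) k else 0)"
      if "supp f \<inter> supp (shift m g) = {}" for f g using that by (auto simp: supp_def fun_eq_iff)
    have "f = (\<lambda>k. if k \<in> supp f then (f + shift m g) k else 0)" by (rule r[OF d(1)])
    also have "\<dots> = (\<lambda>k. if k \<in> supp f' then (f' + shift m g') k else 0)"
      using e by (simp only: h_def prod.case prod.inject)
    also have "\<dots> = f'" by (rule r[OF d(2), symmetric])
    finally have "f = f'" .
    moreover from this e have "shift m g = shift m g'" by (simp add: h_def)
    then have "g = g'" using inj_shift by (meson injD)
    ultimately show "f = f' \<and> g = g'" by simp
  qed
  moreover have "h ` ?P \<subseteq> Sigma C (\<lambda>c. Pow (supp c))"
    by (auto simp: h_def C_def supp_def)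
  moreover have finC: "finite C" using finP by (simp add: C_def)
  ultimately have "card ?P \<le> card (Sigma C (\<lambda>c. Pow (supp c)))"
    using c by (intro card_inj_on_le) auto
  also have "\<dots> = (\<Sum>c\<in>C. 2 ^ card (supp c))"
    using c finC by (simp add: card_SigmaI card_Pow)
  also have "\<dots> \<le> (\<Sum>c\<in>C. 4 ^ s)"
  proof (rule sum_mono)
    fix x assume "x \<in> C"
    then have "(2::nat) ^ card (supp x) \<le> 2 ^ (2 * s)" using c by (intro power_increasing) auto
    then show "(2::nat) ^ card (supp x) \<le> 4 ^ s" by (simp add: power_mult)
  qed
  also have "\<dots> \<le> 4 ^ s * card (E + shift m ` E)"
  proof -
    have "C \<subseteq> E + shift m ` E" by (auto simp: C_def intro!: set_plus_intro)
    then have "card C \<le> card (E + shift m ` E)"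
      using assms(1) by (intro card_mono finite_set_plus finite_imageI)
    then show ?thesis by simp
  qed
  finally show ?thesis .
qed

text \<open>A pair \<open>(f, g)\<close> fails for \<open>i\<close> only if \<open>n * i\<close> is
  a difference of a point of \<open>supp f\<close> and a point of \<open>supp g\<close>. This
  excludes at most \<open>s\<^sup>2\<close> of the \<open>2 * s\<^sup>2\<close> indices, so double
  counting yields an index that is good for half of the pairs.\<close>

lemma exists_shift_many_disjoint_pairs:
  assumes "finite E" "\<And>f. f \<in> E \<Longrightarrow> finite (supp f) \<and> card (supp f) \<le> s" "n > 0" "s > 0"
  shows "\<exists>i\<in>{1..2 * s\<^sup>2}.
    (card E)\<^sup>2 \<le> 2 * card {(f, g) \<in> E \<times> E. supp f \<inter> supp (shift (n * i) g) = {}}"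
proof (rule ccontr)
  define P where "P i = {(f, g) \<in> E \<times> E. supp f \<inter> supp (shift (n * i) g) = {}}" for i
  let ?I = "{1..2 * s\<^sup>2}"
  assume "\<not> ?thesis"
  then have less: "2 * card (P i) < (card E)\<^sup>2" if "i \<in> ?I" for i
    using that by (auto simp: P_def not_le)
  have good: "s\<^sup>2 \<le> card {i \<in> ?I. p \<in> P i}" if pE: "p \<in> E \<times> E" for p
  proof -
    obtain f g where p: "p = (f, g)" "f \<in> E" "g \<in> E" using pE by auto
    have "{i \<in> ?I. p \<notin> P i} \<subseteq> (\<lambda>(u, v). (u - v) div n) ` (supp f \<times> supp g)"
    proof clarify
      fix i assume "p \<notin> P i"
      then obtain k where "k \<in> supp f" "k \<in> supp (shift (n * i) g)" using p by (auto simp: P_def)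
      then have "(k, k - n * i) \<in> supp f \<times> supp g" "(k - (k - n * i)) div n = i"
        using assms(3) by (auto simp: supp_def shift_def split: if_splits)
      then show "i \<in> (\<lambda>(u, v). (u - v) div n) ` (supp f \<times> supp g)" by force
    qed
    then have "card {i \<in> ?I. p \<notin> P i} \<le> card (supp f \<times> supp g)"
      using assms(2)[OF p(2)] assms(2)[OF p(3)] by (intro surj_card_le) auto
    also have "\<dots> \<le> s\<^sup>2"
      using assms(2)[OF p(2)] assms(2)[OF p(3)]
      by (simp add: card_cartesian_product power2_eq_square mult_le_mono)
    finally have "card {i \<in> ?I. p \<notin> P i} \<le> s\<^sup>2" .
    moreover have "?I = {i \<in> ?I. p \<in> P i} \<union> {i \<in> ?I. p \<notin> P i}" by blast
    then have "card ?I \<le> card {i \<in> ?I. p \<in> P i} + card {i \<in> ?I. p \<notin> P i}"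
      by (metis (no_types, lifting) card_Un_le)
    ultimately show ?thesis by simp
  qed
  have sub: "P i \<subseteq> E \<times> E" for i by (auto simp: P_def)
  have "(\<Sum>i\<in>?I. card (P i)) = (\<Sum>i\<in>?I. card {p \<in> E \<times> E. p \<in> P i})"
    using sub by (intro sum.cong arg_cong[of _ _ card]) auto
  also have "\<dots> = (\<Sum>p\<in>E \<times> E. card {i \<in> ?I. p \<in> P i})"
    using assms(1) by (intro sum_multicount_gen) auto
  also have "\<dots> \<ge> (\<Sum>p\<in>E \<times> E. s\<^sup>2)" by (intro sum_mono good)
  finally have "s\<^sup>2 * (card E)\<^sup>2 \<le> (\<Sum>i\<in>?I. card (P i))"
    by (simp add: card_cartesian_product power2_eq_square mult.commute)
  moreover have "(\<Sum>i\<in>?I. 2 * card (P i)) < (\<Sum>i\<in>?I. (card E)\<^sup>2)"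
    using less assms(4) by (intro sum_strict_mono) auto
  then have "2 * (\<Sum>i\<in>?I. card (P i)) < 2 * (s\<^sup>2 * (card E)\<^sup>2)"
    by (simp add: sum_distrib_left mult.assoc)
  ultimately show False by linarith
qed

section \<open>The combinatorial bound\<close>

text \<open>The statement uses only integer sequences: the shift by \<open>n\<close> stands for
  multiplication by \<alpha>, and the sign \<open>e\<close> may depend on \<open>i\<close> because
  compression erases it.\<close>

lemma card_le_of_small_shift_sums:
  fixes K :: real
  assumes fin: "finite F" and N: "F \<subseteq> below N" and n: "n > 0" and s: "s > 0"
    and K: "1 \<le> K" "K\<^sup>2 \<le> 2 ^ s"
    and diff: "card (F + flip (\<lambda>_. -1) ` F) \<le> K\<^sup>2 * card F"
    and shift: "\<And>i. i \<ge> 1 \<Longrightarrow> \<exists>e. (e = 1 \<or> e = -1) \<and>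
      card (F + flip (\<lambda>_. e) ` shift (n * i) ` F) \<le> K ^ i * card F"
  shows "card F \<le> 8 * 4 ^ s * K ^ (2 * s\<^sup>2)"
proof (cases "F = {}")
  case False
  define D where "D = compress_upto N F"
  have D: "finite D" "card D = card F" "D \<subseteq> below N"
    using fin compress_upto_below[OF N order.refl]
    by (simp_all add: D_def finite_compress_upto card_compress_upto)
  \<comment> \<open>All coordinates from \<open>N\<close> on vanish on \<open>F\<close>, so
    compressing below \<open>N\<close> is enough for a down-set.\<close>
  have "down_at j F" if "N \<le> j" for j
    unfolding down_at_def
  proof (intro ballI conjI allI impI)
    fix f assume "f \<in> F"
    then have fj: "f j = 0" using N that by (auto simp: below_def)
    then show "0 \<le> f j" by simp
    fix t assume "0 \<le> t \<and> t \<le> f j"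
    then have "t = f j" using fj by simp
    then show "f(j := t) \<in> F" using \<open>f \<in> F\<close> by simp
  qed
  then have down: "down_at j D" for j
    unfolding D_def using fin by (intro down_at_compress_upto)
  have "card (D + D) \<le> card (F + flip (\<lambda>_. -1) ` F)"
    using card_compress_upto_plus_le[OF fin finite_imageI[OF fin, of "flip (\<lambda>_. -1)"], of N]
      compress_upto_flip_below[OF _ N, of "\<lambda>_. -1"] by (simp add: D_def)
  with diff K(2) have DD: "card (D + D) \<le> 2 ^ s * card D"
  proof -
    have "real (card (D + D)) \<le> K\<^sup>2 * card F"
      using \<open>card (D + D) \<le> _\<close> diff by linarith
    also have "\<dots> \<le> 2 ^ s * real (card F)" using K(2) by (intro mult_right_mono) auto
    finally have "real (card (D + D)) \<le> real (2 ^ s * card D)" using D(2) by simp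
    then show ?thesis by (simp only: of_nat_le_iff)
  qed
  have shiftD: "real (card (D + shift (n * i) ` D)) \<le> K ^ i * card D" if i: "i \<ge> 1" for i
  proof -
    obtain e where e: "e = 1 \<or> e = -1" "card (F + flip (\<lambda>_. e) ` shift (n * i) ` F) \<le> K ^ i * card F"
      using shift[OF i] by blast
    \<comment> \<open>Both summands must be compressed up to the same bound. Up to
      \<open>?M\<close>, the set \<open>F\<close> still becomes \<open>D\<close>, and its shift
      becomes the shift of \<open>D\<close>.\<close>
    let ?M = "N + n * i" and ?G = "shift (n * i) ` F"
    have G: "?G \<subseteq> below ?M" using N by (force simp: shift_def below_def)
    have "compress_upto ?M (flip (\<lambda>_. e) ` ?G) = shift (n * i) ` D"
      using compress_upto_flip_below[OF _ G, of "\<lambda>_. e"] e(1) by (simp add: compress_upto_shift D_def)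
    moreover have "compress_upto ?M F = D"
      using N by (simp add: compress_upto_beyond D_def)
    ultimately have "card (D + shift (n * i) ` D) \<le> card (F + flip (\<lambda>_. e) ` ?G)"
      using card_compress_upto_plus_le[OF fin, of "flip (\<lambda>_. e) ` ?G" ?M] fin by simp
    with e(2) D(2) show ?thesis by simp
  qed
  define E where "E = {f \<in> D. card (supp f) \<le> s}"
  have E: "finite E" "E \<subseteq> D" "\<And>f. f \<in> E \<Longrightarrow> finite (supp f) \<and> card (supp f) \<le> s"
    using D finite_supp by (auto simp: E_def)
  \<comment> \<open>Elements outside \<open>E\<close> have at least \<open>s + 1\<close> points in
    their support, so each weighs at least \<open>2 ^ Suc s\<close>; against \<open>DD\<close> this
    leaves at most half of \<open>D\<close> outside \<open>E\<close>.\<close>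
  have "2 * card (D - E) * 2 ^ s = (\<Sum>f\<in>D - E. 2 ^ Suc s)" by simp
  also have "\<dots> \<le> (\<Sum>f\<in>D - E. 2 ^ card (supp f))"
    by (intro sum_mono power_increasing) (auto simp: E_def)
  also have "\<dots> \<le> (\<Sum>f\<in>D. 2 ^ card (supp f))"
    using D(1) by (intro sum_mono2) auto
  also have "\<dots> \<le> card (D + D)" by (rule card_downset_double_ge[OF D(1) down D(3)])
  also note DD
  finally have "2 * card (D - E) \<le> card D" by simp
  moreover have "card D = card E + card (D - E)"
    using D(1) E(2) by (metis card_Diff_subset card_mono finite_subset le_add_diff_inverse)
  ultimately have DE: "card D \<le> 2 * card E" by linarith
  obtain i where i: "i \<in> {1..2 * s\<^sup>2}"
    and "(card E)\<^sup>2 \<le> 2 * card {(f, g) \<in> E \<times> E. supp f \<inter> supp (shift (n * i) g) = {}}"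
    using exists_shift_many_disjoint_pairs[OF E(1,3) n s] by blast
  note this(2)
  also have "2 * card {(f, g) \<in> E \<times> E. supp f \<inter> supp (shift (n * i) g) = {}}
      \<le> 2 * (4 ^ s * card (E + shift (n * i) ` E))"
    using card_disjoint_pairs_le[OF E(1,3)] by simp
  also have "\<dots> \<le> 2 * (4 ^ s * card (D + shift (n * i) ` D))"
    using D(1) E(2) by (intro mult_le_mono card_mono finite_set_plus set_plus_mono2) auto
  finally have "(card E)\<^sup>2 \<le> 2 * (4 ^ s * card (D + shift (n * i) ` D))" .
  then have "real ((card E)\<^sup>2) \<le> real (2 * (4 ^ s * card (D + shift (n * i) ` D)))"
    by (simp only: of_nat_le_iff)
  also have "\<dots> = 2 * (4 ^ s * real (card (D + shift (n * i) ` D)))" by simp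
  also have "\<dots> \<le> 2 * (4 ^ s * (K ^ (2 * s\<^sup>2) * card D))"
  proof -
    have "K ^ i \<le> K ^ (2 * s\<^sup>2)" using i K(1) by (intro power_increasing) auto
    then have "K ^ i * card D \<le> K ^ (2 * s\<^sup>2) * card D" by (intro mult_right_mono) auto
    then show ?thesis using shiftD[of i] i by (intro mult_left_mono) auto
  qed
  finally have E2: "(real (card E))\<^sup>2 \<le> 2 * (4 ^ s * (K ^ (2 * s\<^sup>2) * card D))"
    by (simp only: of_nat_power)
  \<comment> \<open>The constant 8 is 4, from squaring \<open>card D \<le> 2 * card E\<close>, times
    2, from keeping half of the pairs.\<close>
  have "(real (card D))\<^sup>2 \<le> (2 * real (card E))\<^sup>2" using DE by (intro power_mono) auto
  also have "\<dots> \<le> 4 * (2 * (4 ^ s * (K ^ (2 * s\<^sup>2) * card D)))" 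
    using mult_left_mono[OF E2, of 4] by (simp only: power_mult_distrib) simp
  finally have "real (card D) * card D \<le> (8 * 4 ^ s * K ^ (2 * s\<^sup>2)) * card D"
    by (simp add: power2_eq_square algebra_simps)
  moreover have "real (card D) > 0" using False fin D(2) by (simp add: card_gt_0_iff)
  ultimately have "real (card D) \<le> 8 * 4 ^ s * K ^ (2 * s\<^sup>2)"
    using mult_right_le_imp_le by blast
  then show ?thesis using D(2) by simp
qed (use K in auto)

section \<open>Coordinates over the ring generated by a transcendental\<close>

definition independent_over :: "real set \<Rightarrow> real set \<Rightarrow> bool" where
  "independent_over R B \<longleftrightarrow>
    (\<forall>c. (\<forall>b\<in>B. c b \<in> R) \<longrightarrow> (\<Sum>b\<in>B. c b * b) = 0 \<longrightarrow> (\<forall>b\<in>B. c b = 0))"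

text \<open>Take \<open>B\<close> maximal independent in \<open>A\<close>. Any further
  \<open>a\<close> satisfies a relation with \<open>B\<close> in which its own coefficient is
  nonzero, by independence of \<open>B\<close>. The product of these coefficients over all
  \<open>a\<close> is a common denominator \<open>q\<close>.\<close>

lemma exists_independent_common_denominator:
  fixes A R :: "real set"
  assumes "finite A" and R: "0 \<in> R" "1 \<in> R" "\<And>x y. x \<in> R \<Longrightarrow> y \<in> R \<Longrightarrow> x * y \<in> R" "\<And>x. x \<in> R \<Longrightarrow> - x \<in> R"
  shows "\<exists>B q c. B \<subseteq> A \<and> independent_over R B \<and> q \<noteq> 0 \<and>
    (\<forall>a\<in>A. q * a = (\<Sum>b\<in>B. c a b * b) \<and> (\<forall>b\<in>B. c a b \<in> R))"
proof -
  define I where "I = {B \<in> Pow A. independent_over R B}"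
  have "finite I" "{} \<in> I" using assms(1) by (simp_all add: I_def independent_over_def)
  then obtain B where "B \<in> I" and "\<forall>C\<in>I. B \<subseteq> C \<longrightarrow> B = C"
    using finite_has_maximal[of I] by blast
  then have B: "B \<subseteq> A" "independent_over R B"
    and max: "\<And>C. C \<subseteq> A \<Longrightarrow> independent_over R C \<Longrightarrow> B \<subseteq> C \<Longrightarrow> B = C"
    by (auto simp: I_def)
  have finB: "finite B" using B assms(1) finite_subset by blast
  have "\<exists>q d. q \<in> R \<and> q \<noteq> 0 \<and> (\<forall>b\<in>B. d b \<in> R) \<and> q * a = (\<Sum>b\<in>B. d b * b)" if a: "a \<in> A" for a
  proof (cases "a \<in> B")
    case True
    have "(\<Sum>b\<in>B. (if b = a then 1 else 0) * b) = (\<Sum>b\<in>B. if b = a then b else 0)"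
      by (intro sum.cong) auto
    also have "\<dots> = a" using True finB by simp
    finally show ?thesis using R
      by (intro exI[of _ 1] exI[of _ "\<lambda>b. if b = a then 1 else 0"]) auto
  next
    case False
    then have "\<not> independent_over R (insert a B)" using max[of "insert a B"] B(1) a by blast
    then obtain c where c: "\<And>b. b \<in> insert a B \<Longrightarrow> c b \<in> R" "(\<Sum>b\<in>insert a B. c b * b) = 0"
      and nz: "\<exists>b\<in>insert a B. c b \<noteq> 0"
      unfolding independent_over_def by blast
    have s: "c a * a + (\<Sum>b\<in>B. c b * b) = 0" using c(2) False finB by simp
    have "c a \<noteq> 0"
    proof
      assume "c a = 0"
      then have "\<forall>b\<in>B. c b = 0" using s B(2) c(1) by (auto simp: independent_over_def)
      with nz \<open>c a = 0\<close> show False by auto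
    qed
    moreover have "c a * a = (\<Sum>b\<in>B. - c b * b)" using s by (simp add: sum_negf)
    ultimately show ?thesis using c(1) R(4) by (intro exI[of _ "c a"] exI[of _ "\<lambda>b. - c b"]) auto
  qed
  then obtain q d where q: "\<And>a. a \<in> A \<Longrightarrow> q a \<in> R" "\<And>a. a \<in> A \<Longrightarrow> q a \<noteq> 0"
    and d: "\<And>a b. a \<in> A \<Longrightarrow> b \<in> B \<Longrightarrow> d a b \<in> R" "\<And>a. a \<in> A \<Longrightarrow> q a * a = (\<Sum>b\<in>B. d a b * b)"
    by metis
  have prodR: "prod q S \<in> R" if "S \<subseteq> A" for S
    using finite_subset[OF that assms(1)] that
    by (induction S rule: finite_induct) (auto intro!: R q)
  have "prod q A * a = (\<Sum>b\<in>B. prod q (A - {a}) * d a b * b)" if "a \<in> A" for a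
  proof -
    have "prod q A * a = prod q (A - {a}) * (q a * a)"
      using prod.remove[OF assms(1) that, of q] by simp
    then show ?thesis unfolding d(2)[OF that] by (simp add: sum_distrib_left mult.assoc)
  qed
  moreover have "prod q (A - {a}) * d a b \<in> R" if "a \<in> A" "b \<in> B" for a b
    using that by (intro R(3) prodR d) auto
  moreover have "prod q A \<noteq> 0" using q(2) assms(1) by simp
  ultimately show ?thesis using B
    by (intro exI[of _ B] exI[of _ "prod q A"] exI[of _ "\<lambda>a b. prod q (A - {a}) * d a b"]) auto
qed

section \<open>The ring \<int>[\<alpha>] and linear forms over it\<close>

text \<open>This is the ring \<int>[\<alpha>], described by real polynomials with integer
  coefficients so as to match \<open>algebraic_def\<close>.\<close>

definition int_poly_values :: "real \<Rightarrow> real set" where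
  "int_poly_values \<alpha> = {poly p \<alpha> | p. \<forall>i. coeff p i \<in> \<int>}"

lemma int_poly_values_closed:
  fixes \<alpha> :: real
  defines "R \<equiv> int_poly_values \<alpha>"
  shows "0 \<in> R" "1 \<in> R" "\<And>x y. x \<in> R \<Longrightarrow> y \<in> R \<Longrightarrow> x * y \<in> R" "\<And>x. x \<in> R \<Longrightarrow> - x \<in> R"
proof -
  show "0 \<in> R" unfolding R_def int_poly_values_def by (rule CollectI, rule exI[of _ 0]) simp
  show "1 \<in> R" unfolding R_def int_poly_values_def by (rule CollectI, rule exI[of _ 1]) (simp add: coeff_1)
  show "- x \<in> R" if "x \<in> R" for x
  proof -
    from that obtain p where "x = poly p \<alpha>" "\<forall>i. coeff p i \<in> \<int>" by (auto simp: R_def int_poly_values_def)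
    then show ?thesis unfolding R_def int_poly_values_def by (intro CollectI exI[of _ "- p"]) simp
  qed
  show "x * y \<in> R" if "x \<in> R" "y \<in> R" for x y
  proof -
    from that obtain p q where "x = poly p \<alpha>" "\<forall>i. coeff p i \<in> \<int>"
      "y = poly q \<alpha>" "\<forall>i. coeff q i \<in> \<int>" by (auto simp: R_def int_poly_values_def)
    then show ?thesis unfolding R_def int_poly_values_def
      by (intro CollectI exI[of _ "p * q"]) (auto simp: coeff_mult intro!: Ints_sum Ints_mult)
  qed
qed

text \<open>
  Index \<open>t * n + j\<close> holds the coefficient of \<open>\<alpha> ^ t\<close> at the \<open>j\<close>-th element of a
  \<open>\<int>[\<alpha>]\<close>-independent family, so multiplication by \<open>\<alpha>\<close> is a shift by \<open>n\<close>.
\<close>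
definition lin_form :: "real \<Rightarrow> (nat \<Rightarrow> real) \<Rightarrow> nat \<Rightarrow> nat \<Rightarrow> (nat \<Rightarrow> int) \<Rightarrow> real" where
  "lin_form \<alpha> b n M f = (\<Sum>t<M. \<Sum>j<n. of_int (f (t * n + j)) * (\<alpha> ^ t * b j))"

lemma lin_form_add: "lin_form \<alpha> b n M (f + g) = lin_form \<alpha> b n M f + lin_form \<alpha> b n M g"
  by (simp add: lin_form_def algebra_simps sum.distrib)

lemma lin_form_diff: "lin_form \<alpha> b n M (f - g) = lin_form \<alpha> b n M f - lin_form \<alpha> b n M g"
  by (simp add: lin_form_def algebra_simps sum_subtractf)

lemma lin_form_flip: "lin_form \<alpha> b n M (flip (\<lambda>_. e) f) = of_int e * lin_form \<alpha> b n M f"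
  by (simp add: lin_form_def flip_def sum_distrib_left mult.assoc)

lemma lin_form_shift: "lin_form \<alpha> b n (M + i) (shift (n * i) f) = \<alpha> ^ i * lin_form \<alpha> b n M f"
proof (induction M)
  case 0
  \<comment> \<open>The first \<open>i\<close> blocks of length \<open>n\<close> occupy the
    positions below \<open>n * i\<close>.\<close>
  have "shift (n * i) f (t * n + j) = 0" if "t < i" "j < n" for t j
  proof -
    have "t * n + j < Suc t * n" using that by simp
    also have "\<dots> \<le> i * n" using that by (intro mult_le_mono1) simp
    finally show ?thesis by (simp add: shift_def mult.commute)
  qed
  then show ?case by (simp add: lin_form_def)
next
  case (Suc M)
  have "shift (n * i) f ((M + i) * n + j) = f (M * n + j)" for j
    by (simp add: shift_def algebra_simps)
  then show ?case using Suc
    by (simp add: lin_form_def sum_distrib_left power_add algebra_simps)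
qed

lemma lin_form_below:
  assumes "f \<in> below (T * n)"
  shows "lin_form \<alpha> b n (T + i) f = lin_form \<alpha> b n T f"
proof (induction i)
  case (Suc i)
  have "f ((T + i) * n + j) = 0" for j using assms by (simp add: below_def algebra_simps)
  then show ?case using Suc by (simp add: lin_form_def)
qed simp

text \<open>Collecting the powers of \<alpha> at each \<open>b j\<close> gives an integer polynomial
  \<open>p j\<close> evaluated at \<alpha>. Independence kills the value, and transcendence then
  kills the polynomial.\<close>

lemma lin_form_eq_0:
  assumes tr: "\<not> algebraic \<alpha>" and n: "n > 0" and f: "f \<in> below (M * n)"
    and ind: "\<And>c. (\<And>j. j < n \<Longrightarrow> c j \<in> int_poly_values \<alpha>) \<Longrightarrow>
      (\<Sum>j<n. c j * b j) = 0 \<Longrightarrow> \<forall>j<n. c j = 0"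
    and 0: "lin_form \<alpha> b n M f = 0"
  shows "f = 0"
proof -
  define p where "p j = (\<Sum>t<M. monom (of_int (f (t * n + j)) :: real) t)" for j
  have coeff_p: "coeff (p j) t = (if t < M then of_int (f (t * n + j)) else 0)" for j t
    by (simp add: p_def coeff_sum coeff_monom if_distrib cong: if_cong)
  have "lin_form \<alpha> b n M f = (\<Sum>j<n. \<Sum>t<M. of_int (f (t * n + j)) * (\<alpha> ^ t * b j))"
    unfolding lin_form_def by (rule sum.swap)
  also have "\<dots> = (\<Sum>j<n. poly (p j) \<alpha> * b j)"
    by (simp add: p_def poly_sum poly_monom sum_distrib_right mult.assoc)
  finally have "(\<Sum>j<n. poly (p j) \<alpha> * b j) = 0" using 0 by simp
  moreover have "\<forall>i. coeff (p j) i \<in> \<int>" for j by (simp add: coeff_p)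
  ultimately have "poly (p j) \<alpha> = 0" if "j < n" for j
    using ind[of "\<lambda>j. poly (p j) \<alpha>"] that unfolding int_poly_values_def by blast
  then have pj: "p j = 0" if "j < n" for j
    using tr that \<open>\<And>j. \<forall>i. coeff (p j) i \<in> \<int>\<close> by (auto simp: algebraic_def)
  have "f k = 0" for k
  proof (cases "k < M * n")
    case True
    then have "k div n < M" "k mod n < n" using n by (auto simp: less_mult_imp_div_less)
    then show ?thesis using coeff_p[of "k mod n" "k div n"] pj[of "k mod n"] by simp
  qed (use f in \<open>simp add: below_def\<close>)
  then show ?thesis by (simp add: fun_eq_iff)
qed

text \<open>Each \<open>a\<close> is encoded by the coefficients of \<open>q * a\<close>. The linear
  form is injective on sequences of bounded support and maps the sumset of codes into the dilate by
  \<open>q\<close> of the real sumset, which gives the inequality.\<close>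

lemma exists_coordinate_model:
  fixes A :: "real set" and \<alpha> :: real
  assumes A: "finite A" "\<not> A \<subseteq> {0}" and tr: "\<not> algebraic \<alpha>"
  obtains F n N where "finite F" "card F = card A" "n > 0" "F \<subseteq> below N"
    "\<And>e i. card (F + flip (\<lambda>_. e) ` shift (n * i) ` F) \<le> card (A + (of_int e * \<alpha> ^ i) *o A)"
proof -
  let ?R = "int_poly_values \<alpha>"
  have "\<exists>B q c. B \<subseteq> A \<and> independent_over ?R B \<and> q \<noteq> 0 \<and>
    (\<forall>a\<in>A. q * a = (\<Sum>b\<in>B. c a b * b) \<and> (\<forall>b\<in>B. c a b \<in> ?R))"
    using A(1) int_poly_values_closed[where \<alpha> = \<alpha>]
    by (intro exists_independent_common_denominator[of A ?R]) simp_all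
  then obtain B q c where H: "B \<subseteq> A \<and> independent_over ?R B \<and> q \<noteq> 0 \<and>
    (\<forall>a\<in>A. q * a = (\<Sum>b\<in>B. c a b * b) \<and> (\<forall>b\<in>B. c a b \<in> ?R))"
    by (elim exE) (rule that)
  then have B: "B \<subseteq> A" "independent_over ?R B"
    and q: "q \<noteq> 0" "\<And>a. a \<in> A \<Longrightarrow> q * a = (\<Sum>b\<in>B. c a b * b)"
    and c: "\<And>a b. a \<in> A \<Longrightarrow> b \<in> B \<Longrightarrow> c a b \<in> ?R"
    by simp_all
  have finB: "finite B" using A(1) B(1) finite_subset by blast
  define n where "n = card B"
  obtain b where b: "bij_betw b {..<n} B"
    using ex_bij_betw_nat_finite[OF finB] by (auto simp: n_def atLeast0LessThan)
  have n: "n > 0"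
  proof -
    \<comment> \<open>With \<open>B\<close> empty, \<open>q * a = 0\<close> for all \<open>a\<close>
      in \<open>A\<close>, although \<open>A\<close> has a nonzero element.\<close>
    have "B \<noteq> {}" using q A(2) by force
    then show ?thesis using finB by (simp add: n_def card_gt_0_iff)
  qed
  \<comment> \<open>Independence of the set \<open>B\<close> is carried over to its enumeration
    \<open>b\<close>.\<close>
  have ind': "\<forall>j<n. d j = 0" if d: "\<And>j. j < n \<Longrightarrow> d j \<in> ?R" "(\<Sum>j<n. d j * b j) = 0" for d
  proof -
    let ?i = "inv_into {..<n} b"
    have i: "?i (b j) = j" if "j < n" for j
      using b that by (simp add: bij_betw_inv_into_left)
    have "(\<Sum>x\<in>B. d (?i x) * x) = (\<Sum>j<n. d (?i (b j)) * b j)"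
      using sum.reindex_bij_betw[OF b, of "\<lambda>x. d (?i x) * x"] by simp
    also have "\<dots> = 0" using d(2) i by simp
    finally have "(\<Sum>x\<in>B. d (?i x) * x) = 0" .
    moreover have "d (?i x) \<in> ?R" if "x \<in> B" for x
      using b that by (intro d(1)) (metis bij_betw_def inv_into_into lessThan_iff)
    ultimately have "\<forall>x\<in>B. d (?i x) = 0"
      using B(2)[unfolded independent_over_def, rule_format, of "\<lambda>x. d (?i x)"] by blast
    then show ?thesis using b i by (metis bij_betw_apply lessThan_iff)
  qed
  have "\<forall>a j. \<exists>p. a \<in> A \<longrightarrow> j < n \<longrightarrow> c a (b j) = poly p \<alpha> \<and> (\<forall>i. coeff p i \<in> \<int>)"
  proof (intro allI)
    fix a j show "\<exists>p. a \<in> A \<longrightarrow> j < n \<longrightarrow> c a (b j) = poly p \<alpha> \<and> (\<forall>i. coeff p i \<in> \<int>)"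
      using c[of a "b j"] bij_betw_apply[OF b, of j] unfolding int_poly_values_def by auto
  qed
  then obtain P where P: "\<And>a j. a \<in> A \<Longrightarrow> j < n \<Longrightarrow> c a (b j) = poly (P a j) \<alpha>"
    "\<And>a j i. a \<in> A \<Longrightarrow> j < n \<Longrightarrow> coeff (P a j) i \<in> \<int>"
    by metis
  define T where "T = Suc (Max ((\<lambda>(a, j). degree (P a j)) ` (A \<times> {..<n})))"
  have T: "degree (P a j) < T" if "a \<in> A" "j < n" for a j
    using A(1) that unfolding T_def less_Suc_eq_le by (intro Max_ge) auto
  \<comment> \<open>The coefficients are integers stored as reals; the floor only changes their
    type.\<close>
  define \<phi> where "\<phi> a k = \<lfloor>coeff (P a (k mod n)) (k div n)\<rfloor>" for a k
  have phi_below: "\<phi> a \<in> below (T * n)" if "a \<in> A" for a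
  proof -
    have "\<phi> a k = 0" if "T * n \<le> k" for k
    proof -
      have "T \<le> k div n" using that n by (simp add: less_eq_div_iff_mult_less_eq)
      then show ?thesis using T[OF \<open>a \<in> A\<close>, of "k mod n"] n by (simp add: \<phi>_def coeff_eq_0)
    qed
    then show ?thesis by (simp add: below_def)
  qed
  have L_phi: "lin_form \<alpha> b n T (\<phi> a) = q * a" if a: "a \<in> A" for a
  proof -
    have "of_int (\<phi> a (t * n + j)) = coeff (P a j) t" if "j < n" for t j
      using P(2)[OF a that, of t] that by (simp add: \<phi>_def)
    then have "lin_form \<alpha> b n T (\<phi> a) = (\<Sum>t<T. \<Sum>j<n. coeff (P a j) t * (\<alpha> ^ t * b j))"
      by (simp add: lin_form_def)
    also have "\<dots> = (\<Sum>j<n. \<Sum>t<T. coeff (P a j) t * (\<alpha> ^ t * b j))"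
      by (rule sum.swap)
    also have "\<dots> = (\<Sum>j<n. poly (P a j) \<alpha> * b j)"
    proof (rule sum.cong[OF refl])
      fix j assume "j \<in> {..<n}"
      then have "(\<Sum>t<T. coeff (P a j) t * \<alpha> ^ t) = (\<Sum>t\<le>degree (P a j). coeff (P a j) t * \<alpha> ^ t)"
        using T[OF a, of j] by (intro sum.mono_neutral_right) (auto simp: coeff_eq_0 not_le)
      then have "(\<Sum>t<T. coeff (P a j) t * \<alpha> ^ t) = poly (P a j) \<alpha>"
        by (simp only: poly_altdef)
      moreover have "(\<Sum>t<T. coeff (P a j) t * (\<alpha> ^ t * b j)) = (\<Sum>t<T. coeff (P a j) t * \<alpha> ^ t) * b j"
        by (simp only: sum_distrib_right mult.assoc)
      ultimately show "(\<Sum>t<T. coeff (P a j) t * (\<alpha> ^ t * b j)) = poly (P a j) \<alpha> * b j"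
        by simp
    qed
    also have "\<dots> = (\<Sum>j<n. c a (b j) * b j)" using P(1)[OF a] by simp
    also have "\<dots> = (\<Sum>x\<in>B. c a x * x)" by (rule sum.reindex_bij_betw[OF b])
    finally show ?thesis using q(2)[OF a] by simp
  qed
  have inj_L: "inj_on (lin_form \<alpha> b n M) (below (M * n))" for M
  proof (rule inj_onI)
    fix f g assume fg: "f \<in> below (M * n)" "g \<in> below (M * n)"
      and "lin_form \<alpha> b n M f = lin_form \<alpha> b n M g"
    then have "lin_form \<alpha> b n M (f - g) = 0" by (simp add: lin_form_diff)
    moreover have "f - g \<in> below (M * n)" using fg by (simp add: below_def)
    ultimately have "f - g = 0" using lin_form_eq_0[OF tr n _ ind'] by blast
    then show "f = g" by simp
  qed
  show ?thesis
  proof (rule that[of "\<phi> ` A" n "T * n"])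
    show "finite (\<phi> ` A)" using A(1) by simp
    show "n > 0" by (rule n)
    show "\<phi> ` A \<subseteq> below (T * n)" by (intro image_subsetI phi_below)
    have "inj_on \<phi> A"
    proof (rule inj_onI)
      fix x y assume xy: "x \<in> A" "y \<in> A" and "\<phi> x = \<phi> y"
      then have "q * x = q * y" using L_phi[OF xy(1)] L_phi[OF xy(2)] by metis
      then show "x = y" using q(1) by simp
    qed
    then show "card (\<phi> ` A) = card A" by (rule card_image)
    fix e :: int and i :: nat
    let ?S = "\<phi> ` A + flip (\<lambda>_. e) ` shift (n * i) ` \<phi> ` A" and ?U = "A + (of_int e * \<alpha> ^ i) *o A"
    let ?L = "lin_form \<alpha> b n (T + i)"
    have fin: "finite ?U" using A(1) by (auto simp: elt_set_times_def intro!: finite_set_plus)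
    have "?S \<subseteq> below ((T + i) * n)"
    proof
      fix h assume "h \<in> ?S"
      then obtain x y where "x \<in> A" "y \<in> A" "h = \<phi> x + flip (\<lambda>_. e) (shift (n * i) (\<phi> y))"
        by (auto simp: set_plus_def)
      then show "h \<in> below ((T + i) * n)"
        using phi_below[of x] phi_below[of y] by (auto simp: below_def flip_def shift_def algebra_simps)
    qed
    then have "inj_on ?L ?S" using inj_L inj_on_subset by blast
    moreover have "?L ` ?S \<subseteq> (*) q ` ?U"
    proof
      fix z assume "z \<in> ?L ` ?S"
      then obtain x y where xy: "x \<in> A" "y \<in> A"
        and z: "z = ?L (\<phi> x + flip (\<lambda>_. e) (shift (n * i) (\<phi> y)))"
        by (auto simp: set_plus_def)
      have "z = q * x + of_int e * (\<alpha> ^ i * (q * y))"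
        unfolding z lin_form_add lin_form_flip lin_form_shift
          lin_form_below[OF phi_below[OF xy(1)]] L_phi[OF xy(1)] L_phi[OF xy(2)] ..
      also have "\<dots> = q * (x + (of_int e * \<alpha> ^ i) * y)" by (simp add: algebra_simps)
      finally show "z \<in> (*) q ` ?U" using xy by (auto simp: elt_set_times_def intro!: imageI set_plus_intro)
    qed
    ultimately have "card ?S \<le> card ((*) q ` ?U)" using fin by (intro card_inj_on_le) auto
    also have "\<dots> \<le> card ?U" by (rule card_image_le[OF fin])
    finally show "card ?S \<le> card ?U" .
  qed
qed

section \<open>Sums of dilates\<close>

lemma card_dilate: "c \<noteq> 0 \<Longrightarrow> card (c *o A) = card A" for c :: real
proof -
  assume "c \<noteq> 0"
  then have "inj_on ((*) c) A" by (auto intro: inj_onI)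
  moreover have "c *o A = (*) c ` A" by (auto simp: elt_set_times_def)
  ultimately show ?thesis by (simp add: card_image)
qed

lemma finite_dilate: "finite A \<Longrightarrow> finite (c *o A)" for c :: real
  by (simp add: elt_set_times_def Setcompr_eq_image)

lemma uminus_dilate: "uminus ` (c *o A) = (- c) *o A" for c :: real
  by (force simp: elt_set_times_def)

text \<open>
  The alternating signs make consecutive differences in the chain \<open>(-\<alpha>) ^ i *o A\<close> dilates of
  the sum \<open>A + \<alpha> *o A\<close>, so that Ruzsa's triangle inequality for differences suffices.
\<close>
lemma card_add_dilate_power_le:
  fixes A :: "real set" and \<alpha> K :: real
  assumes A: "finite A" "A \<noteq> {}" and "\<alpha> \<noteq> 0" and K: "card (A + \<alpha> *o A) \<le> K * card A"
  shows "card (A + (- ((- \<alpha>) ^ Suc i)) *o A) \<le> K ^ Suc i * card A"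
proof (induction i)
  case (Suc i)
  \<comment> \<open>\<open>?Y\<close> is the middle set in Ruzsa's inequality: \<open>A - ?Y\<close>
    is the sum bounded by the induction hypothesis, and \<open>?Y + ?Z\<close> is a dilate of
    \<open>A + \<alpha> *o A\<close>.\<close>
  let ?Y = "((- \<alpha>) ^ Suc i) *o A" and ?Z = "(- ((- \<alpha>) ^ Suc (Suc i))) *o A"
  have pos: "real (card A) > 0" using A by (simp add: card_gt_0_iff)
  have K0: "K \<ge> 0"
  proof -
    have "0 \<le> K * card A" using K by linarith
    then show ?thesis using pos by (simp add: zero_le_mult_iff)
  qed
  have "?Z = ((- \<alpha>) ^ Suc i) *o (\<alpha> *o A)" by (simp add: set_times_rearrange2 mult_ac)
  then have "?Y + ?Z = ((- \<alpha>) ^ Suc i) *o (A + \<alpha> *o A)"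
    by (simp only: set_times_plus_distrib2)
  then have YZ: "card (?Y + ?Z) = card (A + \<alpha> *o A)"
    using assms(3) by (simp only: card_dilate power_eq_0_iff neg_equal_0_iff_equal simp_thms not_False_eq_True)
  have Y: "card ?Y = card A" using assms(3) by (intro card_dilate) simp
  have "card (A + ?Z) * card ?Y \<le> card (A + uminus ` ?Y) * card (?Y + ?Z)"
    using A(1) by (intro ruzsa_triangle finite_dilate)
  then have "card (A + ?Z) * card A \<le> card (A + (- ((- \<alpha>) ^ Suc i)) *o A) * card (A + \<alpha> *o A)"
    unfolding Y YZ uminus_dilate .
  then have "real (card (A + ?Z)) * card A
      \<le> real (card (A + (- ((- \<alpha>) ^ Suc i)) *o A)) * card (A + \<alpha> *o A)"
    by (metis of_nat_le_iff of_nat_mult)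
  also have "\<dots> \<le> (K ^ Suc i * card A) * (K * card A)"
    using Suc.IH K K0 by (intro mult_mono) auto
  also have "\<dots> = (K ^ Suc (Suc i) * card A) * card A" by simp
  finally show ?case using pos by (rule mult_right_le_imp_le)
qed (use K in simp)

text \<open>In Ruzsa's inequality with middle set \<open>(- \<alpha>) *o A\<close>, both factors on
  the right have the size of \<open>A + \<alpha> *o A\<close>.\<close>

lemma card_add_neg_le:
  fixes A :: "real set" and \<alpha> K :: real
  assumes A: "finite A" "A \<noteq> {}" and "\<alpha> \<noteq> 0" and K: "card (A + \<alpha> *o A) \<le> K * card A"
  shows "card (A + (- 1) *o A) \<le> K\<^sup>2 * card A"
proof -
  let ?Y = "(- \<alpha>) *o A" and ?Z = "(- 1) *o A"
  have pos: "real (card A) > 0" using A by (simp add: card_gt_0_iff)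
  have "?Y + ?Z = (- 1) *o (A + \<alpha> *o A)"
    by (simp add: set_times_plus_distrib2 set_times_rearrange2 add.commute)
  then have YZ: "card (?Y + ?Z) = card (A + \<alpha> *o A)" by (simp add: card_dilate)
  have Y: "card ?Y = card A" using assms(3) by (intro card_dilate) simp
  have "card (A + ?Z) * card ?Y \<le> card (A + uminus ` ?Y) * card (?Y + ?Z)"
    using A(1) by (intro ruzsa_triangle finite_dilate)
  then have "card (A + ?Z) * card A \<le> card (A + \<alpha> *o A) * card (A + \<alpha> *o A)"
    unfolding Y YZ uminus_dilate by simp
  then have "real (card (A + ?Z)) * card A \<le> real (card (A + \<alpha> *o A)) * card (A + \<alpha> *o A)"
    by (metis of_nat_le_iff of_nat_mult)
  also have "\<dots> \<le> (K * card A) * (K * card A)"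
    using K by (intro mult_mono) (auto intro: order_trans[OF _ K])
  also have "\<dots> = (K\<^sup>2 * card A) * card A" by (simp add: power2_eq_square)
  finally show ?thesis using pos by (rule mult_right_le_imp_le)
qed

lemma card_le_of_small_dilate_sum:
  fixes A :: "real set" and \<alpha> K :: real
  assumes A: "finite A" "card A \<ge> 2" and tr: "\<not> algebraic \<alpha>"
    and K: "1 \<le> K" "K\<^sup>2 \<le> 2 ^ s" "s > 0" "card (A + \<alpha> *o A) \<le> K * card A"
  shows "card A \<le> 8 * 4 ^ s * K ^ (2 * s\<^sup>2)"
proof -
  have "A \<noteq> {}" using A(2) by auto
  have "\<not> A \<subseteq> {0}" using A(2) card_mono[of "{0}" A] by auto
  have "\<alpha> \<noteq> 0" using tr by auto
  obtain F n N where F: "finite F" "card F = card A" "n > 0" "F \<subseteq> below N"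
    and le: "\<And>e i. card (F + flip (\<lambda>_. e) ` shift (n * i) ` F) \<le> card (A + (of_int e * \<alpha> ^ i) *o A)"
    using exists_coordinate_model[OF A(1) \<open>\<not> A \<subseteq> {0}\<close> tr] by blast
  \<comment> \<open>The case \<open>i = 0\<close> of the coordinate model is the difference
    set.\<close>
  have "shift 0 = id" by (auto simp: shift_def)
  then have "card (F + flip (\<lambda>_. -1) ` F) \<le> card (A + (-1) *o A)"
    using le[of "-1" 0] by simp
  then have diff: "card (F + flip (\<lambda>_. -1) ` F) \<le> K\<^sup>2 * card F"
    using card_add_neg_le[OF A(1) \<open>A \<noteq> {}\<close> \<open>\<alpha> \<noteq> 0\<close> K(4)] F(2) by simp
  have sh: "\<exists>e. (e = 1 \<or> e = -1) \<and>
      card (F + flip (\<lambda>_. e) ` shift (n * i) ` F) \<le> K ^ i * card F" if i: "i \<ge> 1" for i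
  proof (intro exI conjI)
    \<comment> \<open>This sign gives the dilate by \<open>- ((- \<alpha>) ^ i)\<close> reached by
      the chain of triangle inequalities.\<close>
    let ?e = "- ((- 1) ^ i) :: int"
    show "?e = 1 \<or> ?e = -1" by (cases "even i") auto
    obtain j where j: "i = Suc j" using i by (cases i) auto
    have "of_int ?e * \<alpha> ^ i = - ((- \<alpha>) ^ i)" by (simp add: power_minus[of \<alpha>])
    then show "card (F + flip (\<lambda>_. ?e) ` shift (n * i) ` F) \<le> K ^ i * card F"
      using le[of ?e i] card_add_dilate_power_le[OF A(1) \<open>A \<noteq> {}\<close> \<open>\<alpha> \<noteq> 0\<close> K(4), of j] F(2) j
      by (metis (no_types, lifting) of_nat_le_iff order_trans)
  qed
  show ?thesis
    using card_le_of_small_shift_sums[OF F(1,4,3) K(3,1,2) diff sh] F(2) by simp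
qed

section \<open>Passing to logarithms\<close>

lemma ln_card_le_log_cubed:
  fixes A :: "real set" and \<alpha> K :: real
  assumes A: "finite A" "card A \<ge> 2" and tr: "\<not> algebraic \<alpha>"
    and K: "2 \<le> K" "card (A + \<alpha> *o A) \<le> K * card A"
  shows "ln (card A) \<le> 27 * log 2 K ^ 3"
proof -
  define L where "L = log 2 K"
  \<comment> \<open>The least choice with \<open>K\<^sup>2 \<le> 2 ^ s\<close>; since
    \<open>L \<ge> 1\<close>, rounding up costs at most one more \<open>L\<close>.\<close>
  define s where "s = nat \<lceil>2 * L\<rceil>"
  have L: "L \<ge> 1" using K(1) by (simp add: L_def le_log_iff)
  then have s: "2 * L \<le> s" "s \<le> 3 * L" "s > 0" by (auto simp: s_def) linarith+
  have "2 powr L = K" using K(1) by (simp add: L_def)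
  then have "K\<^sup>2 = 2 powr (2 * L)" by (simp only: mult_2 powr_add power2_eq_square)
  also have "\<dots> \<le> 2 powr s" using s(1) by simp
  finally have "K\<^sup>2 \<le> 2 ^ s" by (simp add: powr_realpow)
  then have "card A \<le> 8 * 4 ^ s * K ^ (2 * s\<^sup>2)"
    using card_le_of_small_dilate_sum[OF A tr _ _ s(3) K(2)] K(1) by simp
  then have "ln (card A) \<le> ln (8 * 4 ^ s * K ^ (2 * s\<^sup>2))"
    using A(2) by (subst ln_le_cancel_iff) (auto intro: less_le_trans)
  also have "\<dots> = ln 2 * (3 + 2 * real s + 2 * (real s)\<^sup>2 * L)"
  proof -
    have "ln (8::real) = 3 * ln 2" "ln (4::real) = 2 * ln 2"
      using ln_realpow[of "2::real" 3] ln_realpow[of "2::real" 2] by simp_all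
    moreover have "ln K = L * ln 2" by (simp add: L_def log_def)
    ultimately show ?thesis using K(1)
      by (simp add: ln_mult ln_realpow algebra_simps)
  qed
  also have "\<dots> \<le> 1 * (3 + 2 * real s + 2 * (real s)\<^sup>2 * L)"
    using L ln_2_less_1 by (intro mult_right_mono add_nonneg_nonneg mult_nonneg_nonneg) auto
  also have "\<dots> \<le> 3 + 2 * (3 * L) + 2 * (3 * L)\<^sup>2 * L"
  proof -
    have "(real s)\<^sup>2 \<le> (3 * L)\<^sup>2" using s(2) by (intro power_mono) auto
    then have "2 * (real s)\<^sup>2 * L \<le> 2 * (3 * L)\<^sup>2 * L" using L by (intro mult_right_mono) auto
    moreover have "2 * real s \<le> 2 * (3 * L)" using s(2) by simp
    ultimately show ?thesis unfolding mult_1 by (intro add_mono order.refl)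
  qed
  also have "\<dots> = 3 + 6 * L + 18 * L ^ 3" by (simp add: power2_eq_square power3_eq_cube)
  \<comment> \<open>As \<open>L \<ge> 1\<close>, every term is at most its coefficient times
    \<open>L ^ 3\<close>, and 3 + 6 + 18 = 27.\<close>
  also have "\<dots> \<le> 27 * L ^ 3"
    using L power_increasing[of 1 3 L] by simp
  finally show ?thesis by (simp add: L_def)
qed

text \<open>The fourth power of \<open>x / 4 \<le> exp (x / 4)\<close> gives
  \<open>ln K ^ 4 \<le> 256 * K\<close>. Passing to base 2 costs at most a factor 2 in the
  logarithm, hence 16 here.\<close>

lemma log_power_4_le: "(1::real) \<le> K \<Longrightarrow> log 2 K ^ 4 \<le> 4096 * K"
proof -
  assume K: "1 \<le> K"
  define x where "x = ln K"
  have x: "x \<ge> 0" "exp x = K" using K by (auto simp: x_def)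
  have "(x / 4) ^ 4 \<le> exp (x / 4) ^ 4"
    using x(1) exp_ge_add_one_self[of "x / 4"] by (intro power_mono) linarith+
  also have "\<dots> = K" using x(2) by (simp flip: exp_of_nat_mult)
  finally have "x ^ 4 \<le> 256 * K" by (simp add: power_divide)
  moreover have "log 2 K \<le> 2 * x"
  proof -
    have "log 2 K * ln 2 = x" by (simp add: log_def x_def)
    moreover have "log 2 K * (1 / 2) \<le> log 2 K * ln 2"
      using K ln2_ge_two_thirds by (intro mult_left_mono) auto
    ultimately show ?thesis by simp
  qed
  then have "log 2 K ^ 4 \<le> (2 * x) ^ 4" using K by (intro power_mono) auto
  ultimately show ?thesis by (simp add: power_mult_distrib)
qed

theorem theorem1p2:
  shows "\<exists>c::real. c > 0 \<and>
    (\<forall>(A::real set) (\<alpha>::real). finite A \<longrightarrow> card A \<ge> 3 \<longrightarrow> \<not> algebraic \<alpha> \<longrightarrow>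
      real (card (A + \<alpha> *o A)) \<ge>
        c * (ln (real (card A)) powr (4/3) / ln (ln (real (card A))) powr (8/3)) * real (card A))"
proof -
  \<comment> \<open>The value of the denominator at \<open>card A = 3\<close>, its minimum over the
    sizes considered; the numerator alone is already bounded by the doubling ratio.\<close>
  define \<delta> where "\<delta> = ln (ln 3 :: real) powr (8/3)"
  have ln3: "ln (3::real) > 1" using ln3_gt_1 .
  then have \<delta>: "\<delta> > 0" by (simp add: \<delta>_def)
  show ?thesis
  \<comment> \<open>663552 is 81 * 4096 * 2: from \<open>(3 * log 2 K) ^ 4\<close>, from
    \<open>log_power_4_le\<close>, and from the factor 2 in \<open>K\<close>.\<close>
  proof (intro exI[of _ "\<delta> / 663552"] conjI allI impI)
    show "\<delta> / 663552 > 0" using \<delta> by simp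
    fix A :: "real set" and \<alpha> :: real
    assume A: "finite A" "card A \<ge> 3" and tr: "\<not> algebraic \<alpha>"
    let ?N = "real (card A)" and ?S = "real (card (A + \<alpha> *o A))"
    \<comment> \<open>Doubling the ratio secures \<open>K \<ge> 2\<close>, because the sumset
      contains a translate of \<open>A\<close>.\<close>
    define K where "K = 2 * (?S / ?N)"
    have N: "?N \<ge> 3" using A(2) by simp
    have "?S \<ge> ?N"
    proof -
      obtain a where "a \<in> A" using A(2) by fastforce
      then have "(\<lambda>x. x + \<alpha> * a) ` A \<subseteq> A + \<alpha> *o A"
        by (auto simp: elt_set_times_def intro!: set_plus_intro)
      then have "card ((\<lambda>x. x + \<alpha> * a) ` A) \<le> card (A + \<alpha> *o A)"
        using A(1) by (intro card_mono finite_set_plus finite_dilate)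
      then show ?thesis by (simp add: card_image)
    qed
    then have K: "K \<ge> 2" "?S \<le> K * ?N" using N by (auto simp: K_def field_simps)
    have "ln ?N \<le> 27 * log 2 K ^ 3"
      using A tr K by (intro ln_card_le_log_cubed) auto
    also have "\<dots> = (3 * log 2 K) ^ 3" by (simp add: power_mult_distrib)
    finally have "ln ?N powr (4/3) \<le> ((3 * log 2 K) ^ 3) powr (4/3)"
      using N by (intro powr_mono2) auto
    also have "\<dots> = (3 * log 2 K) ^ 4"
    proof -
      have "3 * log 2 K > 0" using K(1) by simp
      then have "(3 * log 2 K) ^ 3 = (3 * log 2 K) powr 3" "(3 * log 2 K) ^ 4 = (3 * log 2 K) powr 4"
        by (simp_all only: powr_numeral)
      then show ?thesis by (simp only: powr_powr) simp
    qed
    also have "\<dots> \<le> 81 * (4096 * K)"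
      using log_power_4_le[of K] K(1) by (simp add: power_mult_distrib)
    finally have num: "ln ?N powr (4/3) \<le> 663552 * (?S / ?N)" by (simp add: K_def)
    have den: "\<delta> \<le> ln (ln ?N) powr (8/3)"
    proof -
      have "ln 3 \<le> ln ?N" using N by simp
      then have "ln (ln 3) \<le> ln (ln ?N)" using ln3 by simp
      then show ?thesis unfolding \<delta>_def using ln3 by (intro powr_mono2) auto
    qed
    have "ln ?N powr (4/3) / ln (ln ?N) powr (8/3) \<le> 663552 * (?S / ?N) / \<delta>"
      using num den \<delta> by (intro frac_le) auto
    then have "\<delta> / 663552 * (ln ?N powr (4/3) / ln (ln ?N) powr (8/3))
        \<le> \<delta> / 663552 * (663552 * (?S / ?N) / \<delta>)"
      using \<delta> by (intro mult_left_mono) auto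
    also have "\<dots> = ?S / ?N" using \<delta> by simp
    finally have "\<delta> / 663552 * (ln ?N powr (4/3) / ln (ln ?N) powr (8/3)) * ?N \<le> ?S / ?N * ?N"
      by (intro mult_right_mono) auto
    also have "\<dots> = ?S" using N by simp
    finally show "?S \<ge> \<delta> / 663552 * (ln ?N powr (4/3) / ln (ln ?N) powr (8/3)) * ?N" .
  qed
qed

end
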